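(* Let $H$ be a real Hilbert space with zero vector $\theta$, let $c\in H$, $r>0$, let $C=\mathbb{B}(c,r)=\{x\in H:\|x-c\|\le r\}$, and let $P_C:H\to C$ be the metric projection onto $C$. The graphical derivative of $P_C$ at a point $\bar{x}\in H$ is given as follows. (i) If $\bar{x}$ is in the interior of $C$, then $DP_C(\bar{x})(y)=\{y\}$ for every $y\in H$. (ii) If $\bar{x}\in H\setminus C$, then $$DP_C(\bar{x})(y)=\left\{\frac{r}{\|\bar{x}-c\|}\Big(y-\frac{\langle \bar{x}-c,y\rangle}{\|\bar{x}-c\|^2}(\bar{x}-c)\Big)\right\}\quad\text{for all } y\in H.$$ (iii) If $\bar{x}$ is in the boundary of $C$, then $$DP_C(\bar{x})(y)=\begin{cases}\left\{y-\dfrac{1}{r^2}\langle \bar{x}-c,y\rangle(\bar{x}-c)\right\} & \text{if } y\in\bar{x}^{\uparrow}_{(c,r)},\\[2mm] \{y\} & \text{if } y\in\bar{x}^{\downarrow}_{(c,r)}.\end{cases}$$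
   Context: For a nonempty closed convex set $C\subset H$, $P_C(x)$ is the unique point $y\in C$ with $\|x-y\|=\inf_{w\in C}\|x-w\|$. For $x$ in the boundary of $\mathbb{B}(c,r)$, define $$x^{\uparrow}_{(c,r)}=\{v\in H\setminus\{\theta\}:\ \exists\,\delta>0\text{ such that }\|(x+tv)-c\|\ge r\ \text{for all } t\in(0,\delta)\},$$ $$x^{\downarrow}_{(c,r)}=\{v\in H\setminus\{\theta\}:\ \exists\,\delta>0\text{ such that }\|(x+tv)-c\|< r\ \text{for all } t\in(0,\delta)\}.$$ For a nonempty subset $\Omega$ of a Banach space $Z$ and $\bar{p}\in\Omega$, the (Bouligand–Severi) tangent cone is $$T_\Omega(\bar{p})=\{q\in Z:\ \exists\, t_k\downarrow 0,\ q_k\to q\text{ with }\bar{p}+t_kq_k\in\Omega\text{ for all }k\in\mathbb{N}\},$$ where $t_k\downarrow0$ means $t_k\to0$ with $t_k>0$. For a single-valued mapping $f:X\to Y$ between Banach spaces with graph $\mathrm{gph}\,f=\{(x,f(x)):x\in X\}$, the graphical derivative of $f$ at $\bar{x}$ is the set-valued mapping $$Df(\bar{x})(v)=\{w\in Y:\ (v,w)\in T_{\mathrm{gph}\,f}(\bar{x},f(\bar{x}))\},\quad v\in X.$$ *)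

theory Defs
  imports "HOL-Analysis.Analysis"
begin

text \<open>A real Hilbert space is a type of sort \<open>{real_inner, banach}\<close>.\<close>

text \<open>The library's \<^const>\<open>closest_point\<close> is restricted to the class \<^class>\<open>heine_borel\<close>, i.e. to
  finite-dimensional spaces, hence the following definition. The value is meaningful only where
  the nearest point exists and is unique, in particular for nonempty closed convex \<open>C\<close>.\<close>

definition metric_proj :: "'a::{real_inner, banach} set \<Rightarrow> 'a \<Rightarrow> 'a" where
  "metric_proj C x = (THE y. y \<in> C \<and> norm (x - y) = (INF w\<in>C. norm (x - w)))"

definition up_directions :: "'a::{real_inner, banach} \<Rightarrow> real \<Rightarrow> 'a \<Rightarrow> 'a set" where
  "up_directions c r x =
     {v. v \<noteq> 0 \<and> (\<exists>\<delta>>0. \<forall>t\<in>{0<..<\<delta>}. norm ((x + t *\<^sub>R v) - c) \<ge> r)}"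

definition down_directions :: "'a::{real_inner, banach} \<Rightarrow> real \<Rightarrow> 'a \<Rightarrow> 'a set" where
  "down_directions c r x =
     {v. v \<noteq> 0 \<and> (\<exists>\<delta>>0. \<forall>t\<in>{0<..<\<delta>}. norm ((x + t *\<^sub>R v) - c) < r)}"

text \<open>The Bouligand--Severi tangent cone. The sequence \<open>t\<close> is positive and tends to \<open>0\<close>; it is not
  required to be monotone.\<close>

definition tangent_cone :: "'z::banach set \<Rightarrow> 'z \<Rightarrow> 'z set" where
  "tangent_cone \<Omega> p =
     {q. \<exists>(t :: nat \<Rightarrow> real) (qs :: nat \<Rightarrow> 'z).
           (\<forall>k. t k > 0) \<and> t \<longlonglongrightarrow> 0 \<and> qs \<longlonglongrightarrow> q \<and> (\<forall>k. p + t k *\<^sub>R qs k \<in> \<Omega>)}"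

definition gph :: "('x \<Rightarrow> 'y) \<Rightarrow> ('x \<times> 'y) set" where
  "gph f = {(x, f x) | x. True}"

text \<open>The product space carries the library's Euclidean product norm; the tangent cone depends
  only on the product topology, so any equivalent product norm gives the same notion.\<close>

definition graphical_derivative ::
  "('x::banach \<Rightarrow> 'y::banach) \<Rightarrow> 'x \<Rightarrow> 'x \<Rightarrow> 'y set" where
  "graphical_derivative f x v = {w. (v, w) \<in> tangent_cone (gph f) (x, f x)}"

end

theory Submission
  imports Defs
begin

text \<open>The projection onto the ball is nonexpansive, so the vectors of any sequence witnessing
  a tangent direction of its graph may be replaced by their limit: the graphical derivative is
  the one-sided directional derivative as soon as the latter exists. Along a ray that stays
  inside the ball the projection is the identity; along a ray that stays outside the open ball
  it is the radial retraction, whose derivative is computed from that of the norm.\<close>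

text \<open>The variational inequality says that the angle at \<open>y\<close> is never acute, so
  expanding \<open>norm (z - w)\<close> around \<open>y\<close> gives a Pythagorean inequality. It
  makes \<open>y\<close> a minimiser and forces every other minimiser to coincide with it, as the
  definite description requires.\<close>

lemma metric_proj_eqI:
  assumes "y \<in> C" and vi: "\<And>w. w \<in> C \<Longrightarrow> (z - y) \<bullet> (w - y) \<le> 0"
  shows "metric_proj C z = y"
proof -
  have pyth: "(norm (z - y))\<^sup>2 + (norm (w - y))\<^sup>2 \<le> (norm (z - w))\<^sup>2" if "w \<in> C" for w
  proof -
    have "(norm (z - w))\<^sup>2 = (norm (z - y))\<^sup>2 + (norm (w - y))\<^sup>2 - 2 * ((z - y) \<bullet> (w - y))"
      by (simp add: power2_norm_eq_inner inner_diff inner_commute)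
    then show ?thesis using vi[OF that] by linarith
  qed
  have le: "norm (z - y) \<le> norm (z - w)" if "w \<in> C" for w
  proof -
    have "(norm (z - y))\<^sup>2 \<le> (norm (z - w))\<^sup>2"
      using pyth[OF that] zero_le_power2[of "norm (w - y)"] by linarith
    then show ?thesis by (rule power2_le_imp_le) simp
  qed
  have inf: "(INF w\<in>C. norm (z - w)) = norm (z - y)"
    using assms(1) le by (intro cInf_eq_minimum) auto
  show ?thesis
    unfolding metric_proj_def inf
  proof (rule the_equality)
    fix w assume "w \<in> C \<and> norm (z - w) = norm (z - y)"
    then have "(norm (w - y))\<^sup>2 \<le> 0" using pyth[of w] by simp
    then show "w = y" by simp
  qed (use assms(1) in simp)
qed

lemma metric_proj_mem: "z \<in> C \<Longrightarrow> metric_proj C z = z"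
  by (rule metric_proj_eqI) auto

text \<open>With \<open>s = r / norm (z - c)\<close>, the vector \<open>z - y\<close> is
  \<open>1 - s\<close> times \<open>z - c\<close>. The sign is thus decided by comparing
  \<open>(z - c) \<bullet> (w - c)\<close> with its value \<open>norm (z - c) * r\<close> at
  \<open>w = y\<close>, which is its maximum over the ball by Cauchy-Schwarz.\<close>

lemma cball_radial_vi:
  fixes c z w :: "'a::real_inner"
  assumes "r > 0" "norm (z - c) \<ge> r" "w \<in> cball c r"
  defines "y \<equiv> c + (r / norm (z - c)) *\<^sub>R (z - c)"
  shows "(z - y) \<bullet> (w - y) \<le> 0"
proof -
  have n: "norm (z - c) > 0" using assms by linarith
  define s where "s = r / norm (z - c)"
  have s: "0 < s" "s \<le> 1" using assms n by (auto simp: s_def)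
  have "(z - c) \<bullet> (w - c) \<le> norm (z - c) * norm (w - c)" by (rule norm_cauchy_schwarz)
  also have "\<dots> \<le> norm (z - c) * r"
    using assms(3) by (intro mult_left_mono) (auto simp: dist_norm norm_minus_commute)
  also have "\<dots> = s * ((z - c) \<bullet> (z - c))"
    using n by (simp add: s_def dot_square_norm power2_eq_square)
  finally have *: "(z - c) \<bullet> (w - c) - s * ((z - c) \<bullet> (z - c)) \<le> 0" by simp
  have z: "z - y = (1 - s) *\<^sub>R (z - c)"
    by (simp add: y_def s_def algebra_simps)
  have w: "w - y = (w - c) - s *\<^sub>R (z - c)"
    by (simp add: y_def s_def)
  have "(z - y) \<bullet> (w - y) = (1 - s) * ((z - c) \<bullet> (w - c) - s * ((z - c) \<bullet> (z - c)))"
    unfolding z w inner_scaleR_left inner_diff_right[of _ "w - c"] inner_scaleR_right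
    by (simp only: right_diff_distrib mult.left_commute)
  then show ?thesis using * s by (simp add: mult_le_0_iff)
qed

lemma metric_proj_cball_outside:
  assumes "r > 0" "norm (z - c) \<ge> r"
  shows "metric_proj (cball c r) z = c + (r / norm (z - c)) *\<^sub>R (z - c)"
  using assms by (intro metric_proj_eqI cball_radial_vi) (auto simp: dist_norm)

text \<open>Input for nonexpansiveness, uniform in \<open>z\<close>: in the ball the first factor of
  the inner product vanishes, outside it the radial formula applies.\<close>

lemma metric_proj_cball_vi:
  assumes "r > 0"
  shows "metric_proj (cball c r) z \<in> cball c r"
    and "w \<in> cball c r \<Longrightarrow>
      (z - metric_proj (cball c r) z) \<bullet> (w - metric_proj (cball c r) z) \<le> 0"
proof (atomize (full), cases "z \<in> cball c r")
  case True
  then show "metric_proj (cball c r) z \<in> cball c r \<and> (w \<in> cball c r \<longrightarrow>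
      (z - metric_proj (cball c r) z) \<bullet> (w - metric_proj (cball c r) z) \<le> 0)"
    by (simp add: metric_proj_mem)
next
  case False
  then have "norm (z - c) \<ge> r" by (simp add: dist_norm norm_minus_commute)
  then show "metric_proj (cball c r) z \<in> cball c r \<and> (w \<in> cball c r \<longrightarrow>
      (z - metric_proj (cball c r) z) \<bullet> (w - metric_proj (cball c r) z) \<le> 0)"
    using assms cball_radial_vi[of r z c w]
    by (auto simp: metric_proj_cball_outside dist_norm)
qed

text \<open>Testing the variational inequality of each projection with the other one and adding
  gives firm nonexpansiveness,
  \<open>(norm (p - q))\<^sup>2 \<le> (a - b) \<bullet> (p - q)\<close>. Cauchy-Schwarz then allows
  one factor \<open>norm (p - q)\<close> to be cancelled.\<close>

lemma metric_proj_cball_nonexpansive: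
  assumes "r > 0"
  shows "norm (metric_proj (cball c r) a - metric_proj (cball c r) b) \<le> norm (a - b)"
proof -
  define p q where "p = metric_proj (cball c r) a" and "q = metric_proj (cball c r) b"
  have "(a - p) \<bullet> (q - p) \<le> 0" "(b - q) \<bullet> (p - q) \<le> 0"
    using assms by (auto simp: p_def q_def intro!: metric_proj_cball_vi simp del: mem_cball)
  then have "(norm (p - q))\<^sup>2 \<le> (a - b) \<bullet> (p - q)"
    by (simp add: power2_norm_eq_inner inner_diff inner_commute)
  also have "\<dots> \<le> norm (a - b) * norm (p - q)" by (rule norm_cauchy_schwarz)
  finally show ?thesis
    unfolding p_def[symmetric] q_def[symmetric]
    by (cases "p = q") (auto simp: power2_eq_square)
qed

lemma graphical_derivative_eq_directional:
  fixes f :: "'x::banach \<Rightarrow> 'y::banach"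
  assumes lip: "\<And>a b. norm (f a - f b) \<le> L * norm (a - b)"
    and lim: "((\<lambda>t. (f (x + t *\<^sub>R v) - f x) /\<^sub>R t) \<longlongrightarrow> d) (at_right 0)"
  shows "graphical_derivative f x v = {d}"
proof -
  define Q where "Q t u = (f (x + t *\<^sub>R u) - f x) /\<^sub>R t" for t u
  have seq: "(\<lambda>k. Q (t k) v) \<longlonglongrightarrow> d" if "\<And>k. t k > 0" "t \<longlonglongrightarrow> 0" for t :: "nat \<Rightarrow> real"
  proof -
    have "filterlim t (at_right 0) sequentially"
      using that by (intro tendsto_imp_filterlim_at_right) auto
    from filterlim_compose[OF lim this] show ?thesis by (simp only: Q_def)
  qed
  have "w = d" if w: "(v, w) \<in> tangent_cone (gph f) (x, f x)" for w
  proof -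
    obtain t qs where t: "\<And>k. t k > 0" "t \<longlonglongrightarrow> 0" and qs: "qs \<longlonglongrightarrow> (v, w)"
      and mem: "\<And>k. (x, f x) + t k *\<^sub>R qs k \<in> gph f"
      using w unfolding tangent_cone_def by blast
    \<comment> \<open>Lying on the graph leaves no freedom in the second component: it is the
      difference quotient in the direction \<open>fst (qs k)\<close>.\<close>
    have snd: "snd (qs k) = Q (t k) (fst (qs k))" for k
    proof -
      have "f x + t k *\<^sub>R snd (qs k) = f (x + t k *\<^sub>R fst (qs k))"
        using mem[of k] by (auto simp: gph_def prod_eq_iff)
      then have "f (x + t k *\<^sub>R fst (qs k)) - f x = t k *\<^sub>R snd (qs k)"
        by (simp add: algebra_simps)
      then show ?thesis using t(1)[of k] by (simp add: Q_def)
    qed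
    have fst: "(\<lambda>k. fst (qs k)) \<longlonglongrightarrow> v" and w: "(\<lambda>k. snd (qs k)) \<longlonglongrightarrow> w"
      using tendsto_fst[OF qs] tendsto_snd[OF qs] by simp_all
    \<comment> \<open>The factor \<open>t k\<close> in the displacement cancels the denominator, so
      the Lipschitz bound on the quotients does not degenerate as \<open>t k\<close> tends to
      0.\<close>
    have bound: "norm (Q (t k) (fst (qs k)) - Q (t k) v) \<le> L * norm (fst (qs k) - v)" for k
    proof -
      have "norm (Q (t k) (fst (qs k)) - Q (t k) v)
          = norm (f (x + t k *\<^sub>R fst (qs k)) - f (x + t k *\<^sub>R v)) / t k"
        using t(1)[of k] unfolding Q_def scaleR_diff_right[symmetric]
        by (simp add: divide_inverse)
      also have "\<dots> \<le> L * norm (t k *\<^sub>R (fst (qs k) - v)) / t k"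
        using lip[of "x + t k *\<^sub>R fst (qs k)" "x + t k *\<^sub>R v"] t(1)[of k]
        by (intro divide_right_mono) (simp_all add: scaleR_diff_right)
      also have "\<dots> = L * norm (fst (qs k) - v)" using t(1)[of k] by simp
      finally show ?thesis .
    qed
    have "(\<lambda>k. L * norm (fst (qs k) - v)) \<longlonglongrightarrow> L * norm (v - v)"
      by (intro tendsto_intros fst)
    then have lim0: "(\<lambda>k. L * norm (fst (qs k) - v)) \<longlonglongrightarrow> 0" by simp
    have "(\<lambda>k. Q (t k) (fst (qs k)) - Q (t k) v) \<longlonglongrightarrow> 0"
      by (rule Lim_null_comparison[OF _ lim0]) (rule always_eventually, use bound in blast)
    from tendsto_add[OF this seq[OF t]] have "(\<lambda>k. snd (qs k)) \<longlonglongrightarrow> d"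
      by (simp add: snd)
    with w show "w = d" by (rule LIMSEQ_unique)
  qed
  moreover have "(v, d) \<in> tangent_cone (gph f) (x, f x)"
    unfolding tangent_cone_def
  proof (intro CollectI exI conjI allI)
    \<comment> \<open>The shift to \<open>Suc k\<close> keeps the step positive at
      \<open>k = 0\<close>. The direction stays \<open>v\<close>, and the second component is the
      exact difference quotient, which puts the points on the graph.\<close>
    let ?t = "\<lambda>k. 1 / real (Suc k)"
    show "?t k > 0" for k by simp
    show t0: "?t \<longlonglongrightarrow> 0" by (rule LIMSEQ_Suc[OF lim_1_over_n])
    have "(\<lambda>k. Q (?t k) v) \<longlonglongrightarrow> d" by (rule seq[OF _ t0]) simp
    then show "(\<lambda>k. (v, Q (?t k) v)) \<longlonglongrightarrow> (v, d)" by (rule tendsto_Pair[OF tendsto_const])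
    show "(x, f x) + ?t k *\<^sub>R (v, Q (?t k) v) \<in> gph f" for k
      by (simp add: gph_def Q_def)
  qed
  ultimately show ?thesis
    unfolding graphical_derivative_def by blast
qed

text \<open>The projection fixes \<open>x\<close> and the nearby points of the ray, so the
  difference quotient is eventually constant. This serves interior points and inward directions at
  the boundary alike.\<close>

lemma graphical_derivative_metric_proj_inside:
  assumes "r > 0" "x \<in> cball c r" "\<forall>\<^sub>F t in at_right 0. x + t *\<^sub>R y \<in> cball c r"
  shows "graphical_derivative (metric_proj (cball c r)) x y = {y}"
proof (rule graphical_derivative_eq_directional[where L = 1])
  have "\<forall>\<^sub>F t in at_right 0.
      (metric_proj (cball c r) (x + t *\<^sub>R y) - metric_proj (cball c r) x) /\<^sub>R t = y"
    using assms(3) eventually_at_right_less[of 0]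
    by eventually_elim (use assms(2) in \<open>simp add: metric_proj_mem del: mem_cball\<close>)
  then show "((\<lambda>t. (metric_proj (cball c r) (x + t *\<^sub>R y) - metric_proj (cball c r) x) /\<^sub>R t)
      \<longlongrightarrow> y) (at_right 0)"
    by (rule tendsto_eventually)
qed (use metric_proj_cball_nonexpansive[OF assms(1)] in simp)

text \<open>Product rule, using that the gradient of the norm at \<open>u\<close> is
  \<open>sgn u\<close>. The result is the component of \<open>y\<close> orthogonal to
  \<open>u\<close>, scaled by \<open>r / norm u\<close>.\<close>

lemma radial_retraction_has_vector_derivative:
  fixes u y :: "'a::real_inner"
  assumes "u \<noteq> 0"
  shows "((\<lambda>t. (r / norm (u + t *\<^sub>R y)) *\<^sub>R (u + t *\<^sub>R y)) has_vector_derivative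
    (r / norm u) *\<^sub>R (y - ((u \<bullet> y) / (norm u)\<^sup>2) *\<^sub>R u)) (at 0 within S)"
proof -
  have ray: "((\<lambda>t. u + t *\<^sub>R y) has_derivative (\<lambda>h. h *\<^sub>R y)) (at 0 within S)"
    by (auto intro!: derivative_eq_intros)
  \<comment> \<open>The base point is written as the value of the ray at 0 so that the chain rule
    applies literally.\<close>
  have "(norm has_derivative (\<lambda>h. h \<bullet> sgn u)) (at (u + 0 *\<^sub>R y))"
    using GDERIV_norm[OF assms] by (simp add: gderiv_def)
  from has_derivative_compose[OF ray this]
  have norm: "((\<lambda>t. norm (u + t *\<^sub>R y)) has_derivative (\<lambda>h. h * (y \<bullet> sgn u))) (at 0 within S)"
    by simp
  show ?thesis
    unfolding has_vector_derivative_def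
    using assms
    by (auto intro!: derivative_eq_intros norm ray ext
        simp: sgn_div_norm inner_commute field_simps power2_eq_square scaleR_diff_right)
qed

text \<open>The weak inequalities let one statement cover exterior points and outward directions at
  the boundary, since the radial formula is also valid on the sphere.\<close>

lemma graphical_derivative_metric_proj_outside:
  assumes "r > 0" "norm (x - c) \<ge> r" "\<forall>\<^sub>F t in at_right 0. norm (x + t *\<^sub>R y - c) \<ge> r"
  shows "graphical_derivative (metric_proj (cball c r)) x y =
    {(r / norm (x - c)) *\<^sub>R (y - (((x - c) \<bullet> y) / (norm (x - c))\<^sup>2) *\<^sub>R (x - c))}"
    (is "_ = {?d}")
proof (rule graphical_derivative_eq_directional[where L = 1])
  \<comment> \<open>Rewrites the normalised remainder from the definition of the derivative as
    difference quotient minus derivative; for positive \<open>t\<close> the norm is \<open>t\<close>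
    itself.\<close>
  have quotient: "(1 / norm (t - 0)) *\<^sub>R (u - (w + (t - 0) *\<^sub>R v)) = (u - w) /\<^sub>R t - v"
    if "t > 0" for t :: real and u v w :: 'a
    using that by (simp add: divide_inverse scaleR_diff_right scaleR_add_right)
  \<comment> \<open>For small \<open>t > 0\<close> and at \<open>t = 0\<close>, this is the
    projection along the ray with the centre \<open>c\<close> subtracted; the centre cancels in the
    difference quotient.\<close>
  let ?g = "\<lambda>t. (r / norm (x - c + t *\<^sub>R y)) *\<^sub>R (x - c + t *\<^sub>R y)"
  have "x - c \<noteq> 0" using assms by auto
  from radial_retraction_has_vector_derivative[OF this, of r y "{0<..}"]
  have "((\<lambda>t. (1 / norm (t - 0)) *\<^sub>R (?g t - (?g 0 + (t - 0) *\<^sub>R ?d))) \<longlongrightarrow> 0) (at_right 0)"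
    unfolding has_vector_derivative_def has_derivative_within by (rule conjunct2)
  moreover have "\<forall>\<^sub>F t in at_right 0.
      (1 / norm (t - 0)) *\<^sub>R (?g t - (?g 0 + (t - 0) *\<^sub>R ?d)) = (?g t - ?g 0) /\<^sub>R t - ?d"
    using eventually_at_right_less[of 0]
    by (rule eventually_mono) (rule quotient)
  ultimately have "((\<lambda>t. (?g t - ?g 0) /\<^sub>R t - ?d) \<longlongrightarrow> 0) (at_right 0)"
    by (rule Lim_transform_eventually)
  then have "((\<lambda>t. (?g t - ?g 0) /\<^sub>R t) \<longlongrightarrow> ?d) (at_right 0)"
    by (rule LIM_zero_cancel)
  moreover have "\<forall>\<^sub>F t in at_right 0. (?g t - ?g 0) /\<^sub>R t =
      (metric_proj (cball c r) (x + t *\<^sub>R y) - metric_proj (cball c r) x) /\<^sub>R t"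
    using assms(3)
    by eventually_elim (use assms in \<open>simp add: metric_proj_cball_outside algebra_simps\<close>)
  ultimately show "((\<lambda>t. (metric_proj (cball c r) (x + t *\<^sub>R y) - metric_proj (cball c r) x) /\<^sub>R t)
      \<longlongrightarrow> ?d) (at_right 0)"
    by (rule Lim_transform_eventually)
qed (use metric_proj_cball_nonexpansive[OF assms(1)] in simp)

theorem theorem4p5:
  fixes c x :: "'a::{real_inner, banach}" and r :: real
  assumes "r > 0"
  shows "(x \<in> interior (cball c r) \<longrightarrow>
            (\<forall>y. graphical_derivative (metric_proj (cball c r)) x y = {y}))
       \<and> (x \<notin> cball c r \<longrightarrow>
            (\<forall>y. graphical_derivative (metric_proj (cball c r)) x y =
              {(r / norm (x - c)) *\<^sub>R (y - (((x - c) \<bullet> y) / (norm (x - c))\<^sup>2) *\<^sub>R (x - c))}))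
       \<and> (x \<in> frontier (cball c r) \<longrightarrow>
            (\<forall>y. (y \<in> up_directions c r x \<longrightarrow>
                    graphical_derivative (metric_proj (cball c r)) x y =
                      {y - ((1 / r\<^sup>2) * ((x - c) \<bullet> y)) *\<^sub>R (x - c)})
               \<and> (y \<in> down_directions c r x \<longrightarrow>
                    graphical_derivative (metric_proj (cball c r)) x y = {y})))"
proof (intro conjI impI allI)
  \<comment> \<open>Open conditions holding at \<open>x\<close> persist along every ray for small
    \<open>t > 0\<close>; this settles the interior and exterior cases.\<close>
  have ray: "((\<lambda>t. x + t *\<^sub>R y) \<longlongrightarrow> x) (at_right 0)" for y
    by (auto intro!: tendsto_eq_intros)
  {
    fix y assume x: "x \<in> interior (cball c r)"
    then have "\<forall>\<^sub>F t in at_right 0. x + t *\<^sub>R y \<in> interior (cball c r)"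
      by (intro topological_tendstoD[OF ray]) auto
    then have "\<forall>\<^sub>F t in at_right 0. x + t *\<^sub>R y \<in> cball c r"
      by (rule eventually_mono) (use interior_subset in blast)
    with x assms show "graphical_derivative (metric_proj (cball c r)) x y = {y}"
      using interior_subset by (intro graphical_derivative_metric_proj_inside) blast+
  }
  {
    fix y assume "x \<notin> cball c r"
    then have x: "norm (x - c) > r" by (simp add: dist_norm norm_minus_commute)
    have "((\<lambda>t. norm (x + t *\<^sub>R y - c)) \<longlongrightarrow> norm (x - c)) (at_right 0)"
      by (intro tendsto_intros ray)
    from order_tendstoD(1)[OF this x]
    have "\<forall>\<^sub>F t in at_right 0. norm (x + t *\<^sub>R y - c) \<ge> r"
      by (rule eventually_mono) simp
    with x assms show "graphical_derivative (metric_proj (cball c r)) x y =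
        {(r / norm (x - c)) *\<^sub>R (y - (((x - c) \<bullet> y) / (norm (x - c))\<^sup>2) *\<^sub>R (x - c))}"
      by (intro graphical_derivative_metric_proj_outside) auto
  }
  assume fr: "x \<in> frontier (cball c r)"
  have "x \<in> cball c r" using fr frontier_subset_closed[of "cball c r"] by auto
  \<comment> \<open>The open ball is an open subset of the closed one, hence lies in its interior,
    which the frontier avoids.\<close>
  moreover have "x \<notin> ball c r"
    using fr interior_maximal[OF ball_subset_cball open_ball, of c r]
    unfolding frontier_def by (meson DiffD2 subsetD)
  ultimately have x: "norm (x - c) = r" by (simp add: dist_norm norm_minus_commute)
  {
    fix y assume "y \<in> up_directions c r x"
    then have "\<forall>\<^sub>F t in at_right 0. norm (x + t *\<^sub>R y - c) \<ge> r"
      by (auto simp: up_directions_def eventually_at_right_field)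
    \<comment> \<open>On the sphere \<open>norm (x - c)\<close> is \<open>r\<close>, so the scaling
      factor becomes 1 and the denominator \<open>r\<^sup>2\<close>.\<close>
    with x assms show "graphical_derivative (metric_proj (cball c r)) x y =
        {y - ((1 / r\<^sup>2) * ((x - c) \<bullet> y)) *\<^sub>R (x - c)}"
      by (simp add: graphical_derivative_metric_proj_outside)
  }
  fix y assume "y \<in> down_directions c r x"
  then obtain \<delta> where "\<delta> > 0" "\<forall>t\<in>{0<..<\<delta>}. norm (x + t *\<^sub>R y - c) < r"
    by (auto simp: down_directions_def)
  then have "\<forall>\<^sub>F t in at_right 0. x + t *\<^sub>R y \<in> cball c r"
    unfolding eventually_at_right_field
    by (intro exI[of _ \<delta>]) (auto simp: dist_norm norm_minus_commute intro: less_imp_le)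
  with \<open>x \<in> cball c r\<close> assms show "graphical_derivative (metric_proj (cball c r)) x y = {y}"
    by (intro graphical_derivative_metric_proj_inside)
qed

end
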